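(* Let $\Pi$ be a convex polygon in the Euclidean plane with vertex set $V=\{\mathbf v_1,\dots,\mathbf v_n\}$, $n\ge 3$, let $\delta$ be a chordal decomposition of $\Pi$, and for each $\mathbf v\in V$ let $|\mathbf v\rangle_\delta\colon\Pi\to\mathbb R$, $\mathbf a\mapsto\langle\mathbf a|\mathbf v\rangle_\delta$, be the chordal coordinate function of $\delta$ at $\mathbf v$. Then: (a) The partition of unity property $\sum_{\mathbf v\in V}|\mathbf v\rangle_\delta=\mathbf 1_\Pi$ holds, i.e. $\sum_{\mathbf v\in V}\langle\mathbf a|\mathbf v\rangle_\delta=1$ for every $\mathbf a\in\Pi$. (b) For every $\mathbf a\in\Pi$, the barycentric (linear precision) property $$\mathbf a=\sum_{\mathbf v\in V}\langle\mathbf a|\mathbf v\rangle_\delta\,\mathbf v$$ holds.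
   Context: Polygon. $\Pi$ is the convex hull in $\mathbb R^2$ of its extreme points (vertices) $\mathbf v_1,\dots,\mathbf v_n$, which are listed in counterclockwise order around the boundary. Its skeleton is the cyclic graph $C_n$ formed by the vertices and boundary edges. A chord is a segment connecting two vertices that are not adjacent in $C_n$. Chordal decomposition. A chordal decomposition $\delta$ of $\Pi$ is a system of $n-3$ non-crossing chords that decompose $\Pi$ as a union of $n-2$ (closed) triangles whose vertices are vertices of $\Pi$ (for $n=3$ the system is empty and the only triangle is $\Pi$). Let $T_\delta$ be the set of these $n-2$ triangles. Areal coordinates. For points $\mathbf x_0,\mathbf x_1,\mathbf x_2$ of the plane, $A(\mathbf x_0,\mathbf x_1,\mathbf x_2)=\tfrac12\det[\mathbf x_1-\mathbf x_0,\mathbf x_2-\mathbf x_0]$ is the signed area. For a triangle $\tau\in T_\delta$ with vertices $\mathbf w_0,\mathbf w_1,\mathbf w_2$ in cyclic counterclockwise order, and for $\mathbf x\in\tau$, the areal coordinate of $\mathbf x$ with respect to $\mathbf w_i$ is $$\langle\mathbf x|\mathbf w_i\rangle_\tau=\frac{A(\mathbf w_{i-1},\mathbf x,\mathbf w_{i+1})}{A(\mathbf w_0,\mathbf w_1,\mathbf w_2)}$$ with indices modulo $3$. Chordal coordinate functions. $\mathbf 1_X$ denotes the indicator function on $\Pi$ of a subset $X\subseteq\Pi$, and products of functions are pointwise; for $X\subseteq\tau$, the product $\mathbf 1_X\cdot|\mathbf v\rangle_\tau$ is the function equal to $\langle\mathbf x|\mathbf v\rangle_\tau$ at $\mathbf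 x\in X$ and $0$ elsewhere on $\Pi$. Fix $\mathbf v\in V$. For sets $S$ of triangles of $T_\delta$ having $\mathbf v$ as a vertex, define recursively $\bigodot_{\sigma\in\varnothing}\mathbf 1_\sigma\cdot|\mathbf v\rangle_\sigma=0$ and, for a further such triangle $\tau\notin S$, $$\bigodot_{\sigma\in S\cup\{\tau\}}\mathbf 1_\sigma\cdot|\mathbf v\rangle_\sigma=\bigodot_{\sigma\in S}\mathbf 1_\sigma\cdot|\mathbf v\rangle_\sigma+\mathbf 1_\tau\cdot|\mathbf v\rangle_\tau-\mathbf 1_{\tau\cap\bigcup\{\sigma\mid\sigma\in S\}}\cdot|\mathbf v\rangle_\tau$$ (the triangles being adjoined one at a time, in any order). The chordal coordinate function of $\delta$ at $\mathbf v$ is $$|\mathbf v\rangle_\delta=\bigodot_{\sigma\in\{\tau\in T_\delta\mid\mathbf v\in\tau\}}\mathbf 1_\sigma\cdot|\mathbf v\rangle_\sigma ,$$ and $\langle\mathbf a|\mathbf v\rangle_\delta$ denotes its value at $\mathbf a\in\Pi$. *)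

theory Defs
  imports "HOL-Analysis.Analysis"
begin

type_synonym point = "real^2"

definition area :: "point \<Rightarrow> point \<Rightarrow> point \<Rightarrow> real" where
  "area x0 x1 x2 = det (transpose (vector [x1 - x0, x2 - x0]) :: real^2^2) / 2"

text \<open>Indices into the vertex list are cyclic. The list runs counterclockwise around the boundary
  when every directed segment from a vertex to its successor has all the remaining vertices strictly
  on its left.\<close>

definition polygon_with_vertices :: "point set \<Rightarrow> point list \<Rightarrow> bool" where
  "polygon_with_vertices P vs \<longleftrightarrow>
     P = convex hull (set vs) \<and>
     {x. x extreme_point_of P} = set vs \<and>
     distinct vs \<and>
     (\<forall>i<length vs. \<forall>j<length vs. j \<noteq> i \<longrightarrow> j \<noteq> Suc i mod length vs \<longrightarrow>
        area (vs ! i) (vs ! (Suc i mod length vs)) (vs ! j) > 0)"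

definition adjacent :: "point list \<Rightarrow> point \<Rightarrow> point \<Rightarrow> bool" where
  "adjacent vs a b \<longleftrightarrow> (\<exists>i<length vs. {a, b} = {vs ! i, vs ! (Suc i mod length vs)})"

definition is_chord :: "point list \<Rightarrow> point set \<Rightarrow> bool" where
  "is_chord vs D \<longleftrightarrow>
     (\<exists>a\<in>set vs. \<exists>b\<in>set vs. a \<noteq> b \<and> \<not> adjacent vs a b \<and> D = closed_segment a b)"

text \<open>The closed pieces into which a system of chords cuts the polygon.\<close>

definition pieces :: "point set \<Rightarrow> point set set \<Rightarrow> point set set" where
  "pieces P \<delta> = closure ` components (P - \<Union>\<delta>)"

text \<open>Two chords cross when they meet in a point interior to both; non-crossing chords may share an
  endpoint. For a chordal decomposition, \<open>pieces P \<delta>\<close> is the set of triangles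
  \<open>T\<^sub>\<delta>\<close>.\<close>

definition chordal_decomposition :: "point set \<Rightarrow> point list \<Rightarrow> point set set \<Rightarrow> bool" where
  "chordal_decomposition P vs \<delta> \<longleftrightarrow>
     (\<forall>D\<in>\<delta>. is_chord vs D) \<and>
     card \<delta> = length vs - 3 \<and>
     pairwise (\<lambda>D E. rel_interior D \<inter> rel_interior E = {}) \<delta> \<and>
     card (pieces P \<delta>) = length vs - 2 \<and>
     (\<forall>\<tau>\<in>pieces P \<delta>. \<exists>a\<in>set vs. \<exists>b\<in>set vs. \<exists>c\<in>set vs.
        a \<noteq> b \<and> b \<noteq> c \<and> c \<noteq> a \<and> \<tau> = convex hull {a, b, c}) \<and>
     P = \<Union>(pieces P \<delta>)"

text \<open>If \<open>v\<close> is the vertex \<open>w\<^sub>i\<close> of the triangle \<open>\<tau>\<close>, then \<open>u\<close> is the next vertex \<open>w\<^bsub>i+1\<^esub>\<close> and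
  \<open>t\<close> is the previous vertex \<open>w\<^bsub>i-1\<^esub>\<close>; this pair is unique, and \<open>area v u t\<close> equals
  \<open>A(w\<^sub>0, w\<^sub>1, w\<^sub>2)\<close> by cyclic invariance.\<close>

definition areal :: "point set \<Rightarrow> point \<Rightarrow> point \<Rightarrow> real" where
  "areal \<tau> v x =
     (let (u, t) = (THE (u, t). \<tau> = convex hull {v, u, t} \<and> area v u t > 0)
      in area t x u / area v u t)"

text \<open>\<open>odot v S f\<close>: adjoining the triangles in \<open>S\<close> one at a time, in some order,
  produces the function \<open>f\<close>.\<close>

inductive odot :: "point \<Rightarrow> point set set \<Rightarrow> (point \<Rightarrow> real) \<Rightarrow> bool" for v where
  empty: "odot v {} (\<lambda>x. 0)"
| adjoin: "odot v S f \<Longrightarrow> \<tau> \<notin> S \<Longrightarrow>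
     odot v (insert \<tau> S)
       (\<lambda>x. f x + indicator \<tau> x * areal \<tau> v x - indicator (\<tau> \<inter> \<Union>S) x * areal \<tau> v x)"

text \<open>The description is legitimate because, for a chordal decomposition, the result does not depend
  on the order in which the triangles are adjoined.\<close>

definition chordal_coordinate :: "point set \<Rightarrow> point set set \<Rightarrow> point \<Rightarrow> point \<Rightarrow> real" where
  "chordal_coordinate P \<delta> v = (THE f. odot v {\<tau> \<in> pieces P \<delta>. v \<in> \<tau>} f)"

end

theory Submission imports Defs begin

text \<open>
  In a single triangle both identities are the defining property of barycentric coordinates, so the
  point is that the chordal coordinates at \<open>a\<close> are the areal coordinates of \<open>a\<close> in any one triangle
  containing \<open>a\<close>, extended by zero to the vertices outside that triangle. This amounts to two claims
  about a point \<open>x\<close> lying in two triangles \<open>\<sigma>\<close> and \<open>\<tau>\<close> of the decomposition: at a common vertex the two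
  areal coordinates of \<open>x\<close> agree, and at a vertex of \<open>\<sigma>\<close> alone the areal coordinate of \<open>x\<close> in \<open>\<sigma>\<close>
  vanishes. Both follow once \<open>x\<close> is a convex combination of the \<^emph>\<open>common\<close> vertices of \<open>\<sigma>\<close> and \<open>\<tau>\<close>,
  because barycentric coefficients in a nondegenerate triangle are unique
  (\<open>areal_eq_barycentric_coefficient\<close>).

  That triangles meet face to face in this sense (\<open>convex_hull_Int_no_three_collinear\<close>) rests on two
  facts: distinct pieces have disjoint interiors, since they are closures of different components
  (\<open>pieces_disjoint_interiors\<close>); and no three extreme points of a convex set are collinear. A line
  separating the two interiors contains every common point of the triangles, but at most two
  vertices of the polygon, and convex hulls of subsets of a set of two points intersect in the hull of the
  common points.

  Finally, the first claim says that the functions glued by the recursion agree on overlaps. The term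
  subtracted at each step then cancels exactly the value already present, so whatever the order
  of adjunction, the result is the common value on the union and zero elsewhere (\<open>odot_value\<close>).
\<close>

section \<open>Areal coordinates are barycentric coefficients\<close>

lemma area_coords:
  "area x y z = ((y$1 - x$1) * (z$2 - x$2) - (z$1 - x$1) * (y$2 - x$2)) / 2"
  by (simp add: area_def det_2 transpose_def)

lemma area_swap: "area x z y = - area x y z"
  by (simp add: area_coords field_simps)

lemma area_eq_0_iff_collinear: "area x y z = 0 \<longleftrightarrow> collinear {x, y, z}"
proof
  assume 0: "area x y z = 0"
  define u w where "u = y - x" and "w = z - x"
  have det: "u$1 * w$2 = w$1 * u$2"
    using 0 by (simp add: area_coords u_def w_def)
  have "u = 0 \<or> w = 0 \<or> (\<exists>c. w = c *\<^sub>R u)"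
  proof (cases "u$1 = 0")
    case True
    show ?thesis
    proof (cases "u$2 = 0")
      case True
      with \<open>u$1 = 0\<close> show ?thesis by (simp add: vec_eq_iff forall_2)
    next
      case False
      with True det have "w = (w$2 / u$2) *\<^sub>R u"
        by (simp add: vec_eq_iff forall_2)
      then show ?thesis by blast
    qed
  next
    case False
    with det have "w = (w$1 / u$1) *\<^sub>R u"
      by (simp add: vec_eq_iff forall_2 field_simps)
    then show ?thesis by blast
  qed
  then have "collinear {0, u, w}"
    by (simp add: collinear_lemma)
  then have "collinear {y, x, z}"
    by (simp add: collinear_3[of y x z] u_def w_def)
  then show "collinear {x, y, z}"
    by (simp add: insert_commute)
next
  assume "collinear {x, y, z}"
  then have "collinear {x, z, y}" by (simp add: insert_commute)
  then obtain c where "x = y \<or> z = c *\<^sub>R x + (1 - c) *\<^sub>R y"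
    unfolding collinear_3_expand by blast
  then show "area x y z = 0"
  proof
    assume z: "z = c *\<^sub>R x + (1 - c) *\<^sub>R y"
    show ?thesis unfolding area_coords z by (simp add: algebra_simps)
  qed (simp add: area_coords)
qed

text \<open>A nondegenerate triangle determines its vertex set as the set of its extreme points; the
  orientation then singles out one of the two ways to list the vertices other than \<open>v\<close>.\<close>

lemma areal_oriented:
  assumes "area v u t > 0"
  shows "areal (convex hull {v, u, t}) v x = area t x u / area v u t"
proof -
  have ext: "{y. y extreme_point_of (convex hull {v, b, c})} = {v, b, c}" if "area v b c > 0" for b c
  proof -
    have "\<not> collinear {v, b, c}"
      using that area_eq_0_iff_collinear[of v b c] by auto
    then have "\<not> affine_dependent {v, b, c}"
      using affine_dependent_imp_collinear_3 by blast
    then show ?thesis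
      by (auto simp: extreme_point_of_convex_hull_affine_independent)
  qed
  have "(THE (b, c). convex hull {v, u, t} = convex hull {v, b, c} \<and> area v b c > 0) = (u, t)"
  proof (rule the_equality)
    fix p
    assume "case p of (b, c) \<Rightarrow> convex hull {v, u, t} = convex hull {v, b, c} \<and> area v b c > 0"
    then obtain b c where p: "p = (b, c)" and hull: "convex hull {v, u, t} = convex hull {v, b, c}"
      and pos: "area v b c > 0"
      by (cases p) auto
    have sets: "{v, u, t} = {v, b, c}"
      by (rule trans[OF ext[OF assms, symmetric, unfolded hull] ext[OF pos]])
    have "v \<noteq> b" "v \<noteq> c" "b \<noteq> c" "v \<noteq> u" "v \<noteq> t" "u \<noteq> t"
      using assms pos by (auto simp: area_coords)
    then have "{u, t} = {b, c}"
      using sets insert_ident[of v "{u, t}" "{b, c}"] by simp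
    then have "b = u \<and> c = t \<or> b = t \<and> c = u"
      by (auto simp: doubleton_eq_iff)
    moreover have "\<not> (b = t \<and> c = u)"
      using assms pos area_swap[of v u t] by auto
    ultimately show "p = (u, t)" using p by auto
  qed (use assms in auto)
  then show ?thesis by (simp add: areal_def)
qed

lemma areal_eq_barycentric_coefficient:
  assumes ncol: "\<not> collinear W" and W: "W = {p, q, r}" and v: "v \<in> W"
    and one: "sum c W = 1" and x: "x = (\<Sum>w\<in>W. c w *\<^sub>R w)"
  shows "areal (convex hull W) v x = c v"
proof -
  obtain b d where W': "W = {v, b, d}"
    using v W by (auto simp: insert_commute)
  then have ne: "area v b d \<noteq> 0"
    using ncol area_eq_0_iff_collinear by auto
  obtain u t where Wut: "W = {v, u, t}" and pos: "area v u t > 0"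
  proof (cases "area v b d > 0")
    case True
    then show ?thesis using W' that by blast
  next
    case False
    then have "area v d b > 0" using ne area_swap[of v b d] by simp
    moreover have "W = {v, d, b}" using W' by auto
    ultimately show ?thesis using that by blast
  qed
  have dist: "v \<noteq> u" "v \<noteq> t" "u \<noteq> t"
    using pos by (auto simp: area_coords)
  have cv: "c v = 1 - c u - c t"
    using one Wut dist by simp
  have xc: "x = c v *\<^sub>R v + c u *\<^sub>R u + c t *\<^sub>R t"
    using x Wut dist by (simp add: add.assoc)
  have "area t x u = c v * area v u t"
    unfolding area_coords xc cv by (simp add: field_simps)
  then show ?thesis
    using areal_oriented[OF pos, of x] Wut pos by simp
qed

section \<open>Triangles without collinear vertices meet face to face\<close>

definition no_three_collinear :: "point set \<Rightarrow> bool" where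
  "no_three_collinear V \<longleftrightarrow>
     (\<forall>p\<in>V. \<forall>q\<in>V. \<forall>r\<in>V. p \<noteq> q \<and> q \<noteq> r \<and> r \<noteq> p \<longrightarrow> \<not> collinear {p, q, r})"

text \<open>Of three collinear points one lies between the other two, so it is not extreme.\<close>

lemma extreme_points_no_three_collinear:
  "no_three_collinear {x. x extreme_point_of P}"
proof -
  have no_between: "\<not> between (p, q) r"
    if "p extreme_point_of P" "q extreme_point_of P" "r extreme_point_of P" "r \<noteq> p" "r \<noteq> q" for p q r
    using that by (auto simp: extreme_point_of_def between_mem_segment open_segment_def)
  have "\<not> collinear {p, q, r}"
    if "p extreme_point_of P" "q extreme_point_of P" "r extreme_point_of P"
      "p \<noteq> q" "q \<noteq> r" "r \<noteq> p" for p q r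
    using that no_between[of q r p] no_between[of r p q] no_between[of p q r]
    unfolding collinear_between_cases by auto
  then show ?thesis
    unfolding no_three_collinear_def by blast
qed

text \<open>The convex combination representing \<open>x\<close> has to put its whole weight on the hyperplane:
  weight on a point with \<open>a \<bullet> w < b\<close> would give \<open>a \<bullet> x < b\<close>.\<close>

lemma convex_hull_supporting_hyperplane:
  fixes W :: "'a::euclidean_space set"
  assumes fin: "finite W" and le: "\<And>w. w \<in> W \<Longrightarrow> a \<bullet> w \<le> b"
    and x: "x \<in> convex hull W" and eq: "a \<bullet> x = b"
  shows "x \<in> convex hull {w \<in> W. a \<bullet> w = b}"
proof -
  obtain c where c: "\<And>w. w \<in> W \<Longrightarrow> 0 \<le> c w" "sum c W = 1" "(\<Sum>w\<in>W. c w *\<^sub>R w) = x"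
    using x by (auto simp: convex_hull_finite[OF fin])
  have "(\<Sum>w\<in>W. c w * (b - a \<bullet> w)) = b * sum c W - a \<bullet> (\<Sum>w\<in>W. c w *\<^sub>R w)"
    by (simp add: algebra_simps sum_subtractf inner_sum_right sum_distrib_left)
  then have "(\<Sum>w\<in>W. c w * (b - a \<bullet> w)) = 0"
    using c eq by simp
  then have "\<forall>w\<in>W. c w * (b - a \<bullet> w) = 0"
    using fin c(1) le by (subst (asm) sum_nonneg_eq_0_iff) auto
  then have zero: "\<And>w. w \<in> W - {w \<in> W. a \<bullet> w = b} \<Longrightarrow> c w = 0"
    by auto
  have "sum c {w \<in> W. a \<bullet> w = b} = sum c W"
    using zero by (intro sum.mono_neutral_left) (auto simp: fin)
  moreover have "(\<Sum>w\<in>{w \<in> W. a \<bullet> w = b}. c w *\<^sub>R w) = (\<Sum>w\<in>W. c w *\<^sub>R w)"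
    using zero by (intro sum.mono_neutral_left) (auto simp: fin)
  ultimately show ?thesis
    using c fin by (auto simp: convex_hull_finite)
qed

text \<open>A line contains at most two points of \<open>V\<close>, and two points are always affinely independent.\<close>

lemma affine_independent_on_line:
  assumes V: "no_three_collinear V" and F: "F \<subseteq> V" and line: "\<And>w. w \<in> F \<Longrightarrow> a \<bullet> w = b"
    and a: "a \<noteq> 0"
  shows "\<not> affine_dependent F"
proof -
  have no3: False if "p \<in> F" "q \<in> F" "r \<in> F" "p \<noteq> q" "q \<noteq> r" "r \<noteq> p" for p q r
  proof -
    have pq: "a$1 * (q$1 - p$1) + a$2 * (q$2 - p$2) = 0"
      and pr: "a$1 * (r$1 - p$1) + a$2 * (r$2 - p$2) = 0"
      using line[OF that(1)] line[OF that(2)] line[OF that(3)]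
      by (simp_all add: inner_vec_def sum_2 algebra_simps)
    have "a$1 * area p q r = 0"
    proof -
      have "a$1 * area p q r = ((a$1 * (q$1 - p$1)) * (r$2 - p$2) - (a$1 * (r$1 - p$1)) * (q$2 - p$2)) / 2"
        by (simp add: area_coords algebra_simps)
      moreover have "a$1 * (q$1 - p$1) = - (a$2 * (q$2 - p$2))" using pq by linarith
      moreover have "a$1 * (r$1 - p$1) = - (a$2 * (r$2 - p$2))" using pr by linarith
      ultimately show ?thesis by simp
    qed
    moreover have "a$2 * area p q r = 0"
    proof -
      have "a$2 * area p q r = ((q$1 - p$1) * (a$2 * (r$2 - p$2)) - (r$1 - p$1) * (a$2 * (q$2 - p$2))) / 2"
        by (simp add: area_coords algebra_simps)
      moreover have "a$2 * (q$2 - p$2) = - (a$1 * (q$1 - p$1))" using pq by linarith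
      moreover have "a$2 * (r$2 - p$2) = - (a$1 * (r$1 - p$1))" using pr by linarith
      ultimately show ?thesis by simp
    qed
    moreover have "a$1 \<noteq> 0 \<or> a$2 \<noteq> 0"
      using a by (auto simp: vec_eq_iff forall_2)
    ultimately have "collinear {p, q, r}"
      using area_eq_0_iff_collinear by auto
    then show False
      using V F that unfolding no_three_collinear_def by blast
  qed
  show ?thesis
  proof (cases "\<exists>p\<in>F. \<exists>q\<in>F. p \<noteq> q")
    case True
    then obtain p q where pq: "p \<in> F" "q \<in> F" "p \<noteq> q" by blast
    have "r = p \<or> r = q" if "r \<in> F" for r
      using no3[OF pq(1,2) that] pq(3) by blast
    then have "F = {p, q}" using pq by blast
    then show ?thesis by simp
  next
    case False
    then have "F = {} \<or> (\<exists>p. F = {p})" by blast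
    then show ?thesis by auto
  qed
qed

text \<open>All common points lie on a line separating the interiors. This line contains at most two points
  of \<open>V\<close>, so the claim reduces to hulls of subsets of an affinely independent set.\<close>

lemma convex_hull_Int_no_three_collinear:
  fixes V :: "point set"
  assumes V: "no_three_collinear V" and sub: "W1 \<subseteq> V" "W2 \<subseteq> V" and fin: "finite W1" "finite W2"
    and ne: "interior (convex hull W1) \<noteq> {}" "interior (convex hull W2) \<noteq> {}"
    and disj: "interior (convex hull W1) \<inter> interior (convex hull W2) = {}"
  shows "convex hull W1 \<inter> convex hull W2 = convex hull (W1 \<inter> W2)"
proof
  obtain a b where a: "a \<noteq> 0"
    and le_int: "\<forall>x\<in>interior (convex hull W1). a \<bullet> x \<le> b"
    and ge_int: "\<forall>x\<in>interior (convex hull W2). a \<bullet> x \<ge> b"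
    using separating_hyperplane_sets[OF _ _ ne disj] by (auto simp: convex_interior)
  have "closure (interior (convex hull W1)) \<subseteq> {x. a \<bullet> x \<le> b}"
    using le_int by (intro closure_minimal closed_halfspace_le) auto
  then have le: "a \<bullet> x \<le> b" if "x \<in> convex hull W1" for x
    using that ne(1) closure_subset[of "convex hull W1"] by (auto simp: convex_closure_interior)
  have "closure (interior (convex hull W2)) \<subseteq> {x. a \<bullet> x \<ge> b}"
    using ge_int by (intro closure_minimal closed_halfspace_ge) auto
  then have ge: "a \<bullet> x \<ge> b" if "x \<in> convex hull W2" for x
    using that ne(2) closure_subset[of "convex hull W2"] by (auto simp: convex_closure_interior)
  let ?F1 = "{w \<in> W1. a \<bullet> w = b}" and ?F2 = "{w \<in> W2. a \<bullet> w = b}"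
  have indep: "\<not> affine_dependent (?F1 \<union> ?F2)"
    by (rule affine_independent_on_line[where b = b, OF V _ _ a]) (use sub in auto)
  show "convex hull W1 \<inter> convex hull W2 \<subseteq> convex hull (W1 \<inter> W2)"
  proof
    fix x assume x: "x \<in> convex hull W1 \<inter> convex hull W2"
    then have eq: "a \<bullet> x = b" using le ge by force
    have "x \<in> convex hull ?F1"
      by (rule convex_hull_supporting_hyperplane[OF fin(1)]) (use x eq in \<open>simp_all add: le hull_inc\<close>)
    moreover have "x \<in> convex hull {w \<in> W2. (-a) \<bullet> w = -b}"
      by (rule convex_hull_supporting_hyperplane[OF fin(2)]) (use x eq in \<open>simp_all add: ge hull_inc\<close>)
    ultimately have "x \<in> convex hull (?F1 \<inter> ?F2)"
      using convex_hull_Int[OF indep] by auto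
    then show "x \<in> convex hull (W1 \<inter> W2)"
      using hull_mono[of "?F1 \<inter> ?F2" "W1 \<inter> W2" convex] by blast
  qed
qed (simp add: hull_mono)

section \<open>Distinct pieces have disjoint interiors\<close>

text \<open>If the interiors met in a nonempty open set \<open>U\<close>, the component dense in the first piece would have a point
  in \<open>U\<close>. As \<open>P - \<Union>\<delta>\<close> is open in the convex, hence locally connected, set \<open>P\<close>, its components
  are open relative to \<open>P\<close>, so that component would even contain a nonempty open subset
  of \<open>U\<close>, which the second, disjoint component, dense in \<open>U\<close>, must hit.\<close>

lemma pieces_disjoint_interiors:
  assumes P: "convex P" "closed P" and \<delta>: "closed (\<Union>\<delta>)"
    and \<sigma>: "\<sigma> \<in> pieces P \<delta>" and \<tau>: "\<tau> \<in> pieces P \<delta>" and ne: "\<sigma> \<noteq> \<tau>"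
  shows "interior \<sigma> \<inter> interior \<tau> = {}"
proof (rule ccontr)
  define U where "U = interior \<sigma> \<inter> interior \<tau>"
  assume "interior \<sigma> \<inter> interior \<tau> \<noteq> {}"
  then have U: "open U" "U \<noteq> {}" "U \<subseteq> \<sigma>" "U \<subseteq> \<tau>"
    using interior_subset by (auto simp: U_def)
  obtain C D where C: "C \<in> components (P - \<Union>\<delta>)" "\<sigma> = closure C"
    and D: "D \<in> components (P - \<Union>\<delta>)" "\<tau> = closure D"
    using \<sigma> \<tau> unfolding pieces_def by blast
  have CD: "C \<inter> D = {}"
    using components_nonoverlap[OF C(1) D(1)] C D ne by auto
  have op: "openin (top_of_set P) (P - \<Union>\<delta>)"
    using \<delta> by (simp add: Diff_eq openin_open_Int open_Compl)
  then have "locally connected (P - \<Union>\<delta>)"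
    using P(1) convex_imp_locally_connected locally_open_subset by blast
  then have "openin (top_of_set P) C"
    using C(1) op openin_components_locally_connected openin_trans by blast
  then obtain G where G: "open G" "C = P \<inter> G"
    by (auto simp: openin_open)
  have "C \<subseteq> P" using G by blast
  then have "U \<subseteq> P"
    using U(3) C(2) P(2) closure_minimal by blast
  then have "U \<inter> G \<subseteq> C" using G by blast
  have "U \<inter> C \<noteq> {}"
    using U C(2) open_Int_closure_eq_empty[OF U(1), of C] by blast
  then have "U \<inter> G \<noteq> {}" using G by blast
  moreover have "(U \<inter> G) \<inter> closure D = U \<inter> G" using U D by blast
  ultimately have "(U \<inter> G) \<inter> D \<noteq> {}"
    using open_Int_closure_eq_empty[of "U \<inter> G" D] U G by (auto simp: open_Int)
  then show False
    using \<open>U \<inter> G \<subseteq> C\<close> CD by blast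
qed

section \<open>The glued function\<close>

lemma odot_exists: "finite S \<Longrightarrow> \<exists>f. odot v S f"
  by (induction S rule: finite_induct) (blast intro: odot.intros)+

text \<open>Where the new triangle overlaps the old ones, coherence makes the added and the subtracted value
  cancel and the old value correct for the new triangle as well.\<close>

lemma odot_value:
  assumes "odot v S f"
    and "\<And>\<sigma> \<tau> x. \<sigma> \<in> S \<Longrightarrow> \<tau> \<in> S \<Longrightarrow> x \<in> \<sigma> \<Longrightarrow> x \<in> \<tau> \<Longrightarrow> areal \<sigma> v x = areal \<tau> v x"
  shows "(\<forall>\<tau>\<in>S. \<forall>x\<in>\<tau>. f x = areal \<tau> v x) \<and> (\<forall>x. x \<notin> \<Union>S \<longrightarrow> f x = 0)"
  using assms
proof (induction rule: odot.induct)
  case empty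
  then show ?case by simp
next
  case (adjoin S f \<tau>)
  let ?g = "\<lambda>x. f x + indicator \<tau> x * areal \<tau> v x - indicator (\<tau> \<inter> \<Union>S) x * areal \<tau> v x"
  have IH: "\<And>\<sigma> x. \<sigma> \<in> S \<Longrightarrow> x \<in> \<sigma> \<Longrightarrow> f x = areal \<sigma> v x" "\<And>x. x \<notin> \<Union>S \<Longrightarrow> f x = 0"
    using adjoin.IH adjoin.prems by (metis insertI2)+
  have old: "?g x = f x" if "x \<in> \<Union>S" for x
    using that by (cases "x \<in> \<tau>") auto
  have "?g x = areal \<sigma> v x" if "\<sigma> \<in> insert \<tau> S" "x \<in> \<sigma>" for \<sigma> x
  proof (cases "x \<in> \<Union>S")
    case True
    then obtain \<rho> where \<rho>: "\<rho> \<in> S" "x \<in> \<rho>" by blast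
    then have "?g x = areal \<rho> v x" using old[OF True] IH(1) by simp
    also have "\<dots> = areal \<sigma> v x"
      using adjoin.prems[of \<rho> \<sigma> x] \<rho> that by blast
    finally show ?thesis .
  next
    case False
    then have "\<sigma> = \<tau>" using that by blast
    then show ?thesis using False that IH(2) by simp
  qed
  moreover have "?g x = 0" if "x \<notin> \<Union>(insert \<tau> S)" for x
    using that IH(2) by simp
  ultimately show ?case by blast
qed

text \<open>The values pin down the function, so every order of adjunction yields the same one and the
  definite description denotes it.\<close>

lemma the_odot_value:
  assumes fin: "finite S"
    and coh: "\<And>\<sigma> \<tau> x. \<sigma> \<in> S \<Longrightarrow> \<tau> \<in> S \<Longrightarrow> x \<in> \<sigma> \<Longrightarrow> x \<in> \<tau> \<Longrightarrow> areal \<sigma> v x = areal \<tau> v x"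
  shows "\<tau> \<in> S \<Longrightarrow> x \<in> \<tau> \<Longrightarrow> (THE f. odot v S f) x = areal \<tau> v x"
    and "x \<notin> \<Union>S \<Longrightarrow> (THE f. odot v S f) x = 0"
proof -
  have unique: "f = g" if "odot v S f" "odot v S g" for f g
  proof
    fix x
    show "f x = g x"
      using odot_value[OF that(1) coh] odot_value[OF that(2) coh] by (cases "x \<in> \<Union>S") auto
  qed
  obtain f where "odot v S f" using odot_exists[OF fin] by blast
  then have "odot v S (THE f. odot v S f)"
    using theI[of "odot v S" f] unique by blast
  note glued = odot_value[OF this coh]
  show "\<tau> \<in> S \<Longrightarrow> x \<in> \<tau> \<Longrightarrow> (THE f. odot v S f) x = areal \<tau> v x"
    and "x \<notin> \<Union>S \<Longrightarrow> (THE f. odot v S f) x = 0"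
    using glued by auto
qed

section \<open>Partition of unity and linear precision\<close>

theorem theorem4p15:
  fixes P :: "point set" and vs :: "point list" and \<delta> :: "point set set"
  assumes "3 \<le> length vs"
    and "polygon_with_vertices P vs"
    and "chordal_decomposition P vs \<delta>"
  shows "(\<forall>a\<in>P. (\<Sum>v\<in>set vs. chordal_coordinate P \<delta> v a) = 1) \<and>
         (\<forall>a\<in>P. a = (\<Sum>v\<in>set vs. chordal_coordinate P \<delta> v a *\<^sub>R v))"
proof -
  let ?V = "set vs" and ?T = "pieces P \<delta>"
  have P: "P = convex hull ?V" and ext: "{x. x extreme_point_of P} = ?V"
    using assms(2) by (auto simp: polygon_with_vertices_def)
  have V: "no_three_collinear ?V"
    using extreme_points_no_three_collinear[of P] ext by simp
  have convP: "convex P" and closedP: "closed P"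
    by (simp_all add: P compact_imp_closed finite_imp_compact_convex_hull)
  have chords: "\<And>D. D \<in> \<delta> \<Longrightarrow> is_chord vs D" and cardT: "card ?T = length vs - 2"
    and cover: "P = \<Union>?T"
    and tri: "\<And>\<tau>. \<tau> \<in> ?T \<Longrightarrow> \<exists>p\<in>?V. \<exists>q\<in>?V. \<exists>r\<in>?V.
                p \<noteq> q \<and> q \<noteq> r \<and> r \<noteq> p \<and> \<tau> = convex hull {p, q, r}"
    using assms(3) by (simp_all add: chordal_decomposition_def)
  have finT: "finite ?T"
    using cardT assms(1) by (intro card_ge_0_finite) simp
  have "\<delta> \<subseteq> (\<lambda>(p, q). closed_segment p q) ` (?V \<times> ?V)"
  proof
    fix D assume "D \<in> \<delta>"
    from chords[OF this] obtain p q where "p \<in> ?V" "q \<in> ?V" "D = closed_segment p q"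
      unfolding is_chord_def by blast
    then show "D \<in> (\<lambda>(p, q). closed_segment p q) ` (?V \<times> ?V)" by auto
  qed
  then have "finite \<delta>" by (rule finite_subset) simp
  moreover have "closed D" if "D \<in> \<delta>" for D
    using chords[OF that] by (auto simp: is_chord_def)
  ultimately have closed_chords: "closed (\<Union>\<delta>)" by auto
  obtain W where W: "\<And>\<tau>. \<tau> \<in> ?T \<Longrightarrow> \<exists>p q r. W \<tau> = {p, q, r} \<and> p \<noteq> q \<and> q \<noteq> r \<and> r \<noteq> p"
    and WV: "\<And>\<tau>. \<tau> \<in> ?T \<Longrightarrow> W \<tau> \<subseteq> ?V" and hullW: "\<And>\<tau>. \<tau> \<in> ?T \<Longrightarrow> \<tau> = convex hull W \<tau>"
  proof -
    have "\<forall>\<tau>\<in>?T. \<exists>X. (\<exists>p q r. X = {p, q, r} \<and> p \<noteq> q \<and> q \<noteq> r \<and> r \<noteq> p) \<and> X \<subseteq> ?V \<and> \<tau> = convex hull X"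
    proof
      fix \<tau> assume "\<tau> \<in> ?T"
      from tri[OF this] obtain p q r where "p \<in> ?V" "q \<in> ?V" "r \<in> ?V"
        "p \<noteq> q \<and> q \<noteq> r \<and> r \<noteq> p" "\<tau> = convex hull {p, q, r}" by blast
      then show "\<exists>X. (\<exists>p q r. X = {p, q, r} \<and> p \<noteq> q \<and> q \<noteq> r \<and> r \<noteq> p) \<and> X \<subseteq> ?V \<and> \<tau> = convex hull X"
        by (intro exI[of _ "{p, q, r}"]) blast
    qed
    then obtain W where "\<forall>\<tau>\<in>?T. (\<exists>p q r. W \<tau> = {p, q, r} \<and> p \<noteq> q \<and> q \<noteq> r \<and> r \<noteq> p) \<and>
        W \<tau> \<subseteq> ?V \<and> \<tau> = convex hull W \<tau>"
      by (rule bchoice[THEN exE])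
    then show ?thesis using that[of W] by blast
  qed
  have finW: "finite (W \<tau>)" if "\<tau> \<in> ?T" for \<tau>
    using W[OF that] by auto
  have ncol: "\<not> collinear (W \<tau>)" if t: "\<tau> \<in> ?T" for \<tau>
  proof -
    obtain p q r where Wt: "W \<tau> = {p, q, r}" and "p \<noteq> q \<and> q \<noteq> r \<and> r \<noteq> p" using W[OF t] by blast
    moreover have "p \<in> ?V" "q \<in> ?V" "r \<in> ?V" using WV[OF t] Wt by auto
    ultimately show ?thesis
      using V unfolding no_three_collinear_def Wt by blast
  qed
  have intW: "interior (convex hull W \<tau>) \<noteq> {}" if t: "\<tau> \<in> ?T" for \<tau>
  proof -
    obtain p q r where Wt: "W \<tau> = {p, q, r}" and "p \<noteq> q" "q \<noteq> r" "r \<noteq> p" using W[OF t] by blast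
    then have "card (W \<tau>) = Suc DIM(point)" by simp
    moreover have "\<not> affine_dependent (W \<tau>)"
      using ncol[OF t] affine_dependent_imp_collinear_3 unfolding Wt by blast
    ultimately show ?thesis
      using interior_convex_hull_eq_empty by blast
  qed
  \<comment> \<open>A polygon vertex lying in a triangle is extreme there, hence one of its vertices.\<close>
  have vertex: "v \<in> W \<tau>" if "\<tau> \<in> ?T" "v \<in> ?V" "v \<in> \<tau>" for \<tau> v
  proof -
    have "v extreme_point_of P" using ext that(2) by blast
    moreover have "\<tau> \<subseteq> P" using equalityD2[OF cover] that(1) by blast
    ultimately have "v extreme_point_of \<tau>"
      using that(3) by (auto simp: extreme_point_of_def)
    then have "v extreme_point_of (convex hull W \<tau>)"
      using hullW[OF that(1)] by simp
    then show ?thesis by (rule extreme_point_of_convex_hull)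
  qed
  have vertex_in: "v \<in> \<tau>" if "\<tau> \<in> ?T" "v \<in> W \<tau>" for \<tau> v
    using hull_inc[OF that(2), of convex] hullW[OF that(1)] by simp
  have face: "x \<in> convex hull (W \<sigma> \<inter> W \<tau>)"
    if "\<sigma> \<in> ?T" "\<tau> \<in> ?T" "x \<in> \<sigma>" "x \<in> \<tau>" for \<sigma> \<tau> x
  proof (cases "\<sigma> = \<tau>")
    case True
    then show ?thesis using hullW[OF that(1)] that(3) by simp
  next
    case False
    have "interior \<sigma> \<inter> interior \<tau> = {}"
      by (rule pieces_disjoint_interiors[OF convP closedP closed_chords that(1,2) False])
    then have "interior (convex hull W \<sigma>) \<inter> interior (convex hull W \<tau>) = {}"
      using hullW that(1,2) by metis
    then have "convex hull W \<sigma> \<inter> convex hull W \<tau> = convex hull (W \<sigma> \<inter> W \<tau>)"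
      using that by (intro convex_hull_Int_no_three_collinear[OF V] WV finW intW)
    moreover have "x \<in> convex hull W \<sigma>" "x \<in> convex hull W \<tau>"
      using hullW that by metis+
    ultimately show ?thesis by blast
  qed
  \<comment> \<open>Barycentric coefficients over the common vertices, extended by zero, serve both triangles.\<close>
  have common: "\<exists>c. sum c (W \<tau>) = 1 \<and> x = (\<Sum>w\<in>W \<tau>. c w *\<^sub>R w) \<and>
      (\<forall>v\<in>W \<tau>. areal \<tau> v x = c v) \<and> (\<forall>v\<in>W \<sigma>. areal \<sigma> v x = c v) \<and> (\<forall>v. v \<notin> W \<tau> \<longrightarrow> c v = 0)"
    if st: "\<sigma> \<in> ?T" "\<tau> \<in> ?T" "x \<in> \<sigma>" "x \<in> \<tau>" for \<sigma> \<tau> x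
  proof -
    let ?C = "W \<sigma> \<inter> W \<tau>"
    have finC: "finite ?C" using finW st by blast
    obtain d where d: "sum d ?C = 1" "(\<Sum>w\<in>?C. d w *\<^sub>R w) = x"
      using face[OF st] by (auto simp: convex_hull_finite[OF finC])
    define c where "c v = (if v \<in> ?C then d v else 0)" for v
    have rep: "sum c (W \<rho>) = 1 \<and> x = (\<Sum>w\<in>W \<rho>. c w *\<^sub>R w)" if "\<rho> \<in> {\<sigma>, \<tau>}" for \<rho>
    proof -
      have fin: "finite (W \<rho>)" and sub: "?C \<subseteq> W \<rho>" using that st finW by auto
      have "sum c (W \<rho>) = sum c ?C"
        by (rule sum.mono_neutral_right[OF fin sub]) (auto simp: c_def)
      also have "\<dots> = sum d ?C" by (rule sum.cong) (auto simp: c_def)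
      finally have one: "sum c (W \<rho>) = 1" using d by simp
      have "(\<Sum>w\<in>W \<rho>. c w *\<^sub>R w) = (\<Sum>w\<in>?C. c w *\<^sub>R w)"
        by (rule sum.mono_neutral_right[OF fin sub]) (auto simp: c_def)
      also have "\<dots> = (\<Sum>w\<in>?C. d w *\<^sub>R w)" by (rule sum.cong) (auto simp: c_def)
      finally show ?thesis using d one by simp
    qed
    have ar: "areal \<rho> v x = c v" if \<rho>: "\<rho> \<in> {\<sigma>, \<tau>}" and v: "v \<in> W \<rho>" for \<rho> v
    proof -
      have T: "\<rho> \<in> ?T" using \<rho> st by auto
      obtain p q r where Wr: "W \<rho> = {p, q, r}" using W[OF T] by blast
      have "areal (convex hull W \<rho>) v x = c v"
        by (rule areal_eq_barycentric_coefficient[OF ncol[OF T] Wr v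
              conjunct1[OF rep[OF \<rho>]] conjunct2[OF rep[OF \<rho>]]])
      then show ?thesis using hullW[OF T] by simp
    qed
    have "\<forall>v. v \<notin> W \<tau> \<longrightarrow> c v = 0" by (simp add: c_def)
    then show ?thesis
      using rep[of \<tau>] ar[of \<tau>] ar[of \<sigma>] by blast
  qed
  have coherent: "areal \<sigma> v x = areal \<tau> v x"
    if "v \<in> ?V" "\<sigma> \<in> {\<tau> \<in> ?T. v \<in> \<tau>}" "\<tau> \<in> {\<tau> \<in> ?T. v \<in> \<tau>}" "x \<in> \<sigma>" "x \<in> \<tau>" for v \<sigma> \<tau> x
  proof -
    have T: "\<sigma> \<in> ?T" "\<tau> \<in> ?T" using that by auto
    from common[OF T that(4,5)]
    obtain c where "\<forall>v\<in>W \<tau>. areal \<tau> v x = c v" "\<forall>v\<in>W \<sigma>. areal \<sigma> v x = c v"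
      by blast
    moreover have "v \<in> W \<sigma>" "v \<in> W \<tau>"
      using vertex[OF T(1) that(1)] vertex[OF T(2) that(1)] that(2,3) by simp_all
    ultimately show ?thesis by simp
  qed
  have fin: "finite {\<tau> \<in> ?T. v \<in> \<tau>}" for v using finT by simp
  have coord: "chordal_coordinate P \<delta> v x = areal \<tau> v x"
    if "v \<in> ?V" "\<tau> \<in> ?T" "v \<in> \<tau>" "x \<in> \<tau>" for v \<tau> x
    unfolding chordal_coordinate_def
    by (rule the_odot_value(1)[OF fin coherent[OF that(1)]]) (use that in auto)
  have coord0: "chordal_coordinate P \<delta> v x = 0"
    if "v \<in> ?V" "\<And>\<tau>. \<tau> \<in> ?T \<Longrightarrow> v \<in> \<tau> \<Longrightarrow> x \<notin> \<tau>" for v x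
    unfolding chordal_coordinate_def
    by (rule the_odot_value(2)[OF fin coherent[OF that(1)]]) (use that in auto)
  have main: "(\<Sum>v\<in>?V. chordal_coordinate P \<delta> v a) = 1 \<and>
      a = (\<Sum>v\<in>?V. chordal_coordinate P \<delta> v a *\<^sub>R v)" if aP: "a \<in> P" for a
  proof -
    obtain \<tau> where \<tau>: "\<tau> \<in> ?T" "a \<in> \<tau>" using equalityD1[OF cover] aP by blast
    obtain c where c: "sum c (W \<tau>) = 1" "a = (\<Sum>w\<in>W \<tau>. c w *\<^sub>R w)"
      and cv: "\<forall>v\<in>W \<tau>. areal \<tau> v a = c v"
      using common[OF \<tau>(1) \<tau>(1) \<tau>(2) \<tau>(2)] by (elim exE conjE) (rule that)
    have inside: "chordal_coordinate P \<delta> v a = c v" if "v \<in> W \<tau>" for v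
    proof -
      have "v \<in> ?V" using WV[OF \<tau>(1)] that by blast
      then show ?thesis
        using coord[OF _ \<tau>(1) vertex_in[OF \<tau>(1) that] \<tau>(2)] bspec[OF cv that] by simp
    qed
    have outside: "chordal_coordinate P \<delta> v a = 0" if v: "v \<in> ?V - W \<tau>" for v
    proof (cases "\<exists>\<sigma>\<in>?T. v \<in> \<sigma> \<and> a \<in> \<sigma>")
      case True
      then obtain \<sigma> where \<sigma>: "\<sigma> \<in> ?T" "v \<in> \<sigma>" "a \<in> \<sigma>" by blast
      have "v \<in> W \<sigma>" using vertex[OF \<sigma>(1) _ \<sigma>(2)] v by blast
      moreover obtain d where "\<forall>v\<in>W \<sigma>. areal \<sigma> v a = d v" "\<forall>v. v \<notin> W \<tau> \<longrightarrow> d v = 0"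
        using common[OF \<sigma>(1) \<tau>(1) \<sigma>(3) \<tau>(2)] by (elim exE conjE) (rule that)
      ultimately have "areal \<sigma> v a = 0" using v by simp
      then show ?thesis using coord[of v \<sigma> a] \<sigma> v by simp
    next
      case False
      then show ?thesis using coord0[of v a] v by blast
    qed
    have "(\<Sum>v\<in>?V. chordal_coordinate P \<delta> v a) = (\<Sum>v\<in>W \<tau>. chordal_coordinate P \<delta> v a)"
      by (rule sum.mono_neutral_right) (use WV[OF \<tau>(1)] outside in auto)
    also have "\<dots> = sum c (W \<tau>)" by (rule sum.cong) (auto simp: inside)
    also note c(1)
    finally have sum1: "(\<Sum>v\<in>?V. chordal_coordinate P \<delta> v a) = 1" .
    have "(\<Sum>v\<in>?V. chordal_coordinate P \<delta> v a *\<^sub>R v) = (\<Sum>v\<in>W \<tau>. chordal_coordinate P \<delta> v a *\<^sub>R v)"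
      by (rule sum.mono_neutral_right) (use WV[OF \<tau>(1)] outside in auto)
    also have "\<dots> = (\<Sum>w\<in>W \<tau>. c w *\<^sub>R w)" by (rule sum.cong) (auto simp: inside)
    also note c(2)[symmetric]
    finally show ?thesis using sum1 by (intro conjI) (assumption, rule sym)
  qed
  then show ?thesis by blast
qed

end
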